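(* Let $f\in\Sigma_6$ be strictly positive. Then $\dim\mathrm{Gram}(f)=3$, and the points in the relative interior of $\mathrm{Gram}(f)$ have rank $4$. Moreover: (a) $\mathrm{Gram}(f)$ has no faces of dimension $1$ or $2$; (b) $\mathrm{Gram}(f)$ has $4$, $3$ or $2$ extreme points of rank $\le 2$; (c) all other extreme points of $\mathrm{Gram}(f)$ have rank $3$.
   Context: Let $V=\mathbb{R}[x_1,x_2]_3$ be the space of real binary cubic forms, and let $\Sigma_6\subset\mathbb{R}[x_1,x_2]_6$ be the cone of sums of squares of forms in $V$. A form $f$ is strictly positive if $f(x)>0$ for all $0\ne x\in\mathbb{R}^2$. Let $\mathsf{S}_2V\subset V\otimes V$ be the space of symmetric tensors, let $\mathsf{S}_2^+V=\{\sum_{i=1}^r p_i\otimes p_i: r\ge 0,\ p_i\in V\}$ be the cone of positive semidefinite symmetric tensors, and let $\mu:\mathsf{S}_2V\to\mathbb{R}[x_1,x_2]_6$ be the linear map induced by multiplication $p\otimes q\mapsto pq$. For $f\in\Sigma_6$, the Gram spectrahedron is $\mathrm{Gram}(f)=\mathsf{S}_2^+V\cap\mu^{-1}(f)$, a closed convex set. The rank of $\theta\in\mathsf{S}_2V$ is the rank of the associated linear map $V^\vee\to V$; for $\theta=\sum_{i=1}^r p_i\otimes p_i$ with $p_1,\dots,p_r$ linearly independent it equals $r$. A convex subset $F$ of a closed convex set $K$ is a face of $K$ if $x,y\in K$, $0<t<1$ and $(1-t)x+ty\in F$ imply $x,y\in F$. The dimension of a convex set is the dimension of its affine hull. *)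

theory Defs
  imports "HOL-Analysis.Analysis"
begin

text \<open>
  A binary form is identified with the polynomial function on \<open>\<real>\<^sup>2\<close> that it defines; this is
  faithful because \<open>\<real>\<close> is infinite. The product of forms is then the pointwise product.
\<close>

definition binary_forms :: "nat \<Rightarrow> (real^2 \<Rightarrow> real) set" where
  "binary_forms d = {p. \<exists>c :: nat \<Rightarrow> real. \<forall>x. p x = (\<Sum>i\<le>d. c i * (x$1)^(d - i) * (x$2)^i)}"

definition strictly_positive :: "(real^2 \<Rightarrow> real) \<Rightarrow> bool" where
  "strictly_positive f \<longleftrightarrow> (\<forall>x. x \<noteq> 0 \<longrightarrow> f x > 0)"

definition Sigma6 :: "(real^2 \<Rightarrow> real) set" where
  "Sigma6 = {f. \<exists>(r::nat) p. (\<forall>i<r. p i \<in> binary_forms 3) \<and> (\<forall>x. f x = (\<Sum>i<r. (p i x)\<^sup>2))}"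

text \<open>
  The space \<open>V\<close> of binary cubic forms is identified with \<open>\<real>\<^sup>4\<close> by means of the monomial basis
  \<open>x\<^sub>1\<^sup>3, x\<^sub>1\<^sup>2x\<^sub>2, x\<^sub>1x\<^sub>2\<^sup>2, x\<^sub>2\<^sup>3\<close>; the lemmas \<open>inj_cubic\<close> and \<open>range_cubic\<close> justify this.
\<close>

definition cubic_monomial :: "real^2 \<Rightarrow> real^4" where
  "cubic_monomial x = vector [(x$1)^3, (x$1)\<^sup>2 * x$2, x$1 * (x$2)\<^sup>2, (x$2)^3]"

definition cubic :: "real^4 \<Rightarrow> real^2 \<Rightarrow> real" where
  "cubic p x = (\<Sum>i\<in>UNIV. p$i * cubic_monomial x $ i)"

text \<open>
  Accordingly \<open>V \<otimes> V\<close> is the space of real \<open>4 \<times> 4\<close> matrices, the \<open>(i, j)\<close> entry being the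
  coefficient of (monomial \<open>i\<close>) \<open>\<otimes>\<close> (monomial \<open>j\<close>). In these coordinates the linear map
  from the dual of \<open>V\<close> to \<open>V\<close> associated with a tensor \<open>\<theta>\<close> is \<open>v \<mapsto> \<theta> *v v\<close>,
  so the rank of a tensor is the rank of the matrix (cf. \<open>rank_dim_range\<close>).
\<close>

type_synonym tensor = "real^4^4"

definition tensor_prod :: "real^4 \<Rightarrow> real^4 \<Rightarrow> tensor" where
  "tensor_prod p q = (\<chi> i j. p$i * q$j)"

definition S2V :: "tensor set" where
  "S2V = {\<theta>. transpose \<theta> = \<theta>}"

definition S2V_plus :: "tensor set" where
  "S2V_plus = {\<theta>. \<exists>(r::nat) (p :: nat \<Rightarrow> real^4). \<theta> = (\<Sum>i<r. tensor_prod (p i) (p i))}"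

text \<open>
  The multiplication map, here given on all of \<open>V \<otimes> V\<close> by its values on the basis tensors;
  see \<open>mult_map_tensor_prod\<close> and the linearity lemmas below.
\<close>

definition mult_map :: "tensor \<Rightarrow> real^2 \<Rightarrow> real" where
  "mult_map \<theta> x = (\<Sum>i\<in>UNIV. \<Sum>j\<in>UNIV. \<theta>$i$j * (cubic_monomial x $ i * cubic_monomial x $ j))"

definition Gram :: "(real^2 \<Rightarrow> real) \<Rightarrow> tensor set" where
  "Gram f = {\<theta> \<in> S2V_plus. mult_map \<theta> = f}"

lemma vector_4 [simp]:
  "(vector [a,b,c,d] :: 'a::zero^4)$1 = a"
  "(vector [a,b,c,d] :: 'a::zero^4)$2 = b"
  "(vector [a,b,c,d] :: 'a::zero^4)$3 = c"
  "(vector [a,b,c,d] :: 'a::zero^4)$4 = d"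
  unfolding vector_def by simp_all

lemma cubic_expand:
  "cubic p x = p$1 * (x$1)^3 + p$2 * (x$1)\<^sup>2 * x$2 + p$3 * x$1 * (x$2)\<^sup>2 + p$4 * (x$2)^3"
  by (simp add: cubic_def cubic_monomial_def sum_4)

lemma cubic_add: "cubic (p + q) x = cubic p x + cubic q x"
  and cubic_scaleR: "cubic (c *\<^sub>R p) x = c * cubic p x"
  by (simp_all add: cubic_expand algebra_simps)

lemma inj_cubic: "inj cubic"
proof (rule injI)
  fix p q assume "cubic p = cubic q"
  then have *: "cubic p (vector [a, b]) = cubic q (vector [a, b])" for a b
    by simp
  show "p = q"
    using *[of 1 0] *[of 0 1] *[of 1 1] *[of 1 "-1"] *[of 1 2]
    by (simp add: cubic_expand vec_eq_iff forall_4)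
qed

lemma range_cubic: "range cubic = binary_forms 3"
proof
  show "range cubic \<subseteq> binary_forms 3"
  proof
    fix f assume "f \<in> range cubic"
    then obtain p where f: "f = cubic p" by blast
    define c :: "nat \<Rightarrow> real" where
      "c i = (if i = 0 then p$1 else if i = 1 then p$2 else if i = 2 then p$3 else p$4)" for i
    have "\<forall>x. f x = (\<Sum>i\<le>3. c i * (x$1)^(3 - i) * (x$2)^i)"
      by (simp add: f cubic_expand c_def numeral_3_eq_3 atMost_Suc numeral_2_eq_2 algebra_simps)
    then show "f \<in> binary_forms 3"
      unfolding binary_forms_def by blast
  qed
  show "binary_forms 3 \<subseteq> range cubic"
  proof
    fix f assume "f \<in> binary_forms 3"
    then obtain c :: "nat \<Rightarrow> real"
      where c: "\<And>x. f x = (\<Sum>i\<le>3. c i * (x$1)^(3 - i) * (x$2)^i)"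
      unfolding binary_forms_def by blast
    have "f = cubic (vector [c 0, c 1, c 2, c 3])"
      by (rule ext) (simp add: c cubic_expand numeral_3_eq_3 atMost_Suc numeral_2_eq_2 algebra_simps)
    then show "f \<in> range cubic" by blast
  qed
qed

lemma tensor_prod_in_S2V: "tensor_prod p p \<in> S2V"
  by (simp add: S2V_def tensor_prod_def transpose_def vec_eq_iff mult.commute)

lemma S2V_plus_subset: "S2V_plus \<subseteq> S2V"
  by (auto simp: S2V_plus_def S2V_def tensor_prod_def transpose_def vec_eq_iff mult.commute)

lemma mult_map_tensor_prod: "mult_map (tensor_prod p q) x = cubic p x * cubic q x"
  by (simp add: mult_map_def tensor_prod_def cubic_def sum_product algebra_simps)

lemma mult_map_add: "mult_map (\<theta> + \<eta>) x = mult_map \<theta> x + mult_map \<eta> x"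
  and mult_map_scaleR: "mult_map (c *\<^sub>R \<theta>) x = c * mult_map \<theta> x"
  by (simp_all add: mult_map_def algebra_simps sum.distrib sum_distrib_left)

end

theory Submission
  imports Defs "HOL-Computational_Algebra.Fundamental_Theorem_Algebra"
begin

text \<open>
  A Gram tensor of \<open>f\<close> is a positive semidefinite tensor \<open>\<theta>\<close> with \<open>\<mu>(\<theta>) = f\<close>, so \<open>Gram f\<close> is a slice of
  the positive semidefinite cone by a translate of the kernel of \<open>\<mu>\<close>. This kernel is the
  three-dimensional space of quadrics containing the twisted cubic. Everything rests on a dichotomy
  between rank four and smaller rank.

  A Gram tensor of rank four is positive definite, hence it can be moved in all three directions of
  the kernel without leaving \<open>Gram f\<close> (\<open>Gram_perturb\<close>). So a single such tensor forces \<open>Gram f\<close> to have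
  dimension three, and the only face that contains it is \<open>Gram f\<close> itself (\<open>face_with_rank_4\<close>).

  A Gram tensor of rank at most three is an extreme point (\<open>extreme_if_rank_le_3\<close>). Otherwise some
  nonzero quadric through the twisted cubic would be singular at a kernel vector \<open>v\<close> of the tensor.
  Such quadrics are singular only at points of the twisted cubic itself (\<open>syzygy_kernel\<close>), so \<open>v\<close>
  would be the evaluation at a real point and \<open>f\<close> would vanish there.

  Consequently the midpoint of two distinct Gram tensors always has rank four. Given that \<open>Gram f\<close> has
  at least two elements, this settles the dimension, the ranks in the relative interior and at the
  extreme points, and the absence of edges and two-dimensional faces: a face with two distinct
  points contains their midpoint and is therefore the whole of \<open>Gram f\<close>.

  It remains to count the Gram tensors of rank at most two. These are the tensors \<open>p \<otimes> p + q \<otimes> q\<close> with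
  \<open>p\<^sup>2 + q\<^sup>2 = f\<close>, that is, \<open>f = \<bar>G\<bar>\<^sup>2\<close> on real points for the complex cubic \<open>G = p + i q\<close>. The roots of
  \<open>f\<close> form three conjugate nonreal pairs, and \<open>G\<close> picks one root from each pair. The tensor determines
  and is determined by \<open>G\<close> up to a scalar of absolute value one and up to conjugation, so at most
  \<open>8 / 2 = 4\<close> tensors arise. The choice of all roots in the upper half-plane is never equivalent
  to a choice with exactly one root in the lower half-plane, so at least two arise
  (\<open>card_Gram_rank_le_2\<close>).
\<close>

section \<open>Positive semidefinite tensors\<close>

lemma tensor_prod_mv: "tensor_prod p q *v x = (q \<bullet> x) *\<^sub>R p"
  by (simp add: vec_eq_iff tensor_prod_def matrix_vector_mult_def inner_vec_def sum_distrib_right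
      sum_distrib_left mult.assoc mult.commute mult.left_commute)

definition psd :: "tensor \<Rightarrow> bool" where
  "psd A \<longleftrightarrow> transpose A = A \<and> (\<forall>x. 0 \<le> x \<bullet> (A *v x))"

lemma symmetric_inner: "transpose A = A \<Longrightarrow> x \<bullet> (A *v y) = y \<bullet> ((A::tensor) *v x)"
  by (metis dot_lmul_matrix inner_commute transpose_matrix_vector)

lemma transpose_plus: "transpose (A + B) = transpose A + transpose (B::tensor)"
  and transpose_minus: "transpose (A - B) = transpose A - transpose (B::tensor)"
  and transpose_scaleR: "transpose (c *\<^sub>R A) = c *\<^sub>R transpose (A::tensor)"
  by (simp_all add: transpose_def vec_eq_iff)

text \<open>
  The discriminant argument: \<open>(x + s y)\<^sup>T A (x + s y)\<close> is a polynomial of degree at most two in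
  \<open>s\<close> that is nowhere negative.
\<close>

lemma psd_Cauchy_Schwarz:
  assumes "psd A"
  shows "(y \<bullet> (A *v x))\<^sup>2 \<le> (x \<bullet> (A *v x)) * (y \<bullet> (A *v y))"
proof -
  let ?a = "x \<bullet> (A *v x)" and ?b = "y \<bullet> (A *v x)" and ?d = "y \<bullet> (A *v y)"
  have q: "0 \<le> ?a + 2 * s * ?b + s\<^sup>2 * ?d" for s
  proof -
    have "0 \<le> (x + s *\<^sub>R y) \<bullet> (A *v (x + s *\<^sub>R y))"
      using assms by (simp add: psd_def)
    moreover have "x \<bullet> (A *v y) = ?b"
      using assms symmetric_inner by (simp add: psd_def)
    ultimately show ?thesis
      by (simp add: matrix_vector_right_distrib matrix_vector_mult_scaleR inner_add_left
          inner_add_right power2_eq_square algebra_simps)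
  qed
  have nn: "?a \<ge> 0" "?d \<ge> 0"
    using assms by (auto simp: psd_def)
  show ?thesis
  proof (cases "?d = 0")
    case True
    have "?b = 0"
    proof (rule ccontr)
      assume "?b \<noteq> 0"
      \<comment> \<open>A nonconstant affine function of \<open>s\<close> takes the value \<open>-1\<close>, here at this \<open>s\<close>.\<close>
      then show False
        using q[of "- (?a + 1) / (2 * ?b)"] True by (simp add: field_simps)
    qed
    then show ?thesis using True by simp
  next
    case False
    then have "?d > 0" using nn by simp
    then show ?thesis
      using q[of "- ?b / ?d"] by (simp add: field_simps power2_eq_square)
  qed
qed

lemma psd_kernel:
  assumes "psd A" "x \<bullet> (A *v x) = 0"
  shows "A *v x = 0"
  using psd_Cauchy_Schwarz[OF assms(1), of "A *v x" x] assms(2) by simp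

lemma psd_add: "psd A \<Longrightarrow> psd B \<Longrightarrow> psd (A + B)"
  by (auto simp: psd_def transpose_plus matrix_vector_mult_add_rdistrib inner_add_right)

lemma psd_scaleR: "psd A \<Longrightarrow> 0 \<le> c \<Longrightarrow> psd (c *\<^sub>R A)"
  by (auto simp: psd_def transpose_scaleR scaleR_matrix_vector_assoc[symmetric])

lemma psd_tensor_square: "psd (tensor_prod p p)"
  using tensor_prod_in_S2V[of p]
  by (auto simp: psd_def S2V_def tensor_prod_mv inner_commute)

lemma psd_sum: "(\<And>i. i \<in> I \<Longrightarrow> psd (g i)) \<Longrightarrow> psd (sum g I)"
proof (induction I rule: infinite_finite_induct)
  case (insert i I)
  then show ?case by (simp add: psd_add)
qed (auto simp: psd_def transpose_def vec_eq_iff)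

text \<open>
  Diagonalization by completing squares. If \<open>x\<^sup>T A x > 0\<close>, subtracting the square of
  \<open>A x / sqrt (x\<^sup>T A x)\<close> leaves a positive semidefinite tensor by the Cauchy-Schwarz inequality,
  and its range is a proper subspace of the range of \<open>A\<close>: it no longer contains \<open>A x\<close>, as \<open>x\<close> has
  moved into the kernel. So the rank drops at each step, which bounds the number of squares by the
  rank. The bound is what identifies tensors of rank at most two with sums of two squares.
\<close>

lemma psd_sum_of_squares:
  assumes "psd A" "rank A \<le> n"
  shows "\<exists>p. A = (\<Sum>i<n. tensor_prod (p i) (p i))"
  using assms
proof (induction n arbitrary: A)
  case 0
  then have "range ((*v) A) \<subseteq> {0}"
    by (simp add: rank_dim_range dim_eq_0)
  then have "A = 0"
    by (auto simp: matrix_eq)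
  then show ?case by simp
next
  case (Suc n)
  show ?case
  proof (cases "\<exists>x. x \<bullet> (A *v x) \<noteq> 0")
    case False
    then have "A *v x = 0" for x
      using psd_kernel[OF Suc.prems(1)] by blast
    then have "A = 0"
      by (simp add: matrix_eq)
    then have "A = (\<Sum>i<Suc n. tensor_prod ((\<lambda>_. 0) i) ((\<lambda>_. 0) i))"
      by (simp add: tensor_prod_def vec_eq_iff)
    then show ?thesis by (rule exI[of _ "\<lambda>_. 0"])
  next
    case True
    then obtain x where x: "x \<bullet> (A *v x) \<noteq> 0" by blast
    define a where "a = x \<bullet> (A *v x)"
    have a: "a > 0"
      using x Suc.prems(1) unfolding psd_def a_def by (metis less_eq_real_def)
    have sym: "transpose A = A"
      using Suc.prems(1) by (simp add: psd_def)
    define q where "q = (1 / sqrt a) *\<^sub>R (A *v x)"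
    define B where "B = A - tensor_prod q q"
    have Bv: "B *v y = A *v y - ((y \<bullet> (A *v x)) / a) *\<^sub>R (A *v x)" for y
      using a by (simp add: B_def matrix_vector_mult_diff_rdistrib tensor_prod_mv q_def inner_commute)
    have symB: "transpose B = B"
      using sym tensor_prod_in_S2V[of q] by (simp add: B_def transpose_minus S2V_def)
    have "0 \<le> y \<bullet> (B *v y)" for y
      using psd_Cauchy_Schwarz[OF Suc.prems(1), of y x] a
      by (simp add: Bv inner_diff_right a_def[symmetric] field_simps power2_eq_square)
    then have B: "psd B"
      using symB by (simp add: psd_def)
    have Bx: "B *v x = 0"
      using a by (simp add: Bv a_def[symmetric])
    \<comment> \<open>If \<open>A x = B y\<close> then, by symmetry, \<open>x\<^sup>T A x = x\<^sup>T B y = y\<^sup>T B x = 0\<close>.\<close>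
    have "range ((*v) B) \<subset> range ((*v) A)"
    proof
      have "B *v y = A *v (y - ((y \<bullet> (A *v x)) / a) *\<^sub>R x)" for y
        by (simp add: Bv matrix_vector_mult_diff_distrib matrix_vector_mult_scaleR)
      then show "range ((*v) B) \<subseteq> range ((*v) A)" by auto
      have "A *v x \<noteq> B *v y" for y
      proof
        assume "A *v x = B *v y"
        then have "a = y \<bullet> (B *v x)"
          using symmetric_inner[OF symB, of x y] by (simp add: a_def)
        then show False using a Bx by simp
      qed
      then have "A *v x \<notin> range ((*v) B)" by blast
      then show "range ((*v) B) \<noteq> range ((*v) A)" by blast
    qed
    then have "rank B < rank A"
      unfolding rank_dim_range
      by (intro dim_psubset)
        (simp add: span_eq_iff[THEN iffD2] linear_subspace_image subspace_UNIV matrix_vector_mul_linear)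
    then have "rank B \<le> n" using Suc.prems(2) by simp
    then obtain p where p: "B = (\<Sum>i<n. tensor_prod (p i) (p i))"
      using Suc.IH[OF B] by blast
    have "A = (\<Sum>i<Suc n. tensor_prod ((p(n := q)) i) ((p(n := q)) i))"
      using p by (simp add: B_def diff_eq_eq)
    then show ?thesis by (rule exI[of _ "p(n := q)"])
  qed
qed

lemma S2V_plus_iff_psd: "A \<in> S2V_plus \<longleftrightarrow> psd A"
proof
  assume "A \<in> S2V_plus"
  then show "psd A"
    by (auto simp: S2V_plus_def intro: psd_sum psd_tensor_square)
next
  assume "psd A"
  then show "A \<in> S2V_plus"
    unfolding S2V_plus_def using psd_sum_of_squares[of A "rank A"] by blast
qed

lemma mult_map_inner: "mult_map \<theta> x = cubic_monomial x \<bullet> (\<theta> *v cubic_monomial x)"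
  by (simp add: mult_map_def inner_vec_def matrix_vector_mult_def sum_distrib_left algebra_simps)

text \<open>
  The univariate polynomial obtained from the sextic form \<open>mult_map \<theta>\<close> by setting the second
  variable to \<open>1\<close>. Since its seven coefficients are those of the form, equality of forms can be
  decided on the line where the second variable is \<open>1\<close>.
\<close>

definition dehomog :: "tensor \<Rightarrow> real poly" where
  "dehomog \<theta> = [: \<theta>$4$4, \<theta>$3$4 + \<theta>$4$3, \<theta>$2$4 + \<theta>$3$3 + \<theta>$4$2,
    \<theta>$1$4 + \<theta>$2$3 + \<theta>$3$2 + \<theta>$4$1, \<theta>$1$3 + \<theta>$2$2 + \<theta>$3$1, \<theta>$1$2 + \<theta>$2$1, \<theta>$1$1 :]"

lemma poly_dehomog: "poly (dehomog \<theta>) t = mult_map \<theta> (vector [t, 1])"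
  by (simp add: dehomog_def mult_map_def cubic_monomial_def sum_4 algebra_simps power2_eq_square
      power3_eq_cube)

lemma mult_map_eq_iff: "mult_map \<theta> = mult_map \<eta> \<longleftrightarrow> dehomog \<theta> = dehomog \<eta>"
proof
  assume "mult_map \<theta> = mult_map \<eta>"
  then have "poly (dehomog \<theta>) = poly (dehomog \<eta>)"
    by (simp add: fun_eq_iff poly_dehomog)
  then show "dehomog \<theta> = dehomog \<eta>"
    by (simp add: poly_eq_poly_eq_iff)
next
  assume *: "dehomog \<theta> = dehomog \<eta>"
  have expand: "mult_map \<theta> x = (\<Sum>k\<le>6. coeff (dehomog \<theta>) k * (x$1)^k * (x$2)^(6-k))" for \<theta> x
    by (simp add: dehomog_def mult_map_def cubic_monomial_def sum_4 eval_nat_numeral algebra_simps)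
  show "mult_map \<theta> = mult_map \<eta>"
    by (rule ext) (simp only: expand *)
qed

section \<open>The kernel of the multiplication map\<close>

text \<open>
  The kernel of \<open>\<mu>\<close> consists of the quadratic relations between the four cubic monomials. It is
  the space of quadrics through the twisted cubic, spanned by the three minors
  \<open>X\<^sub>1X\<^sub>3 - X\<^sub>2\<^sup>2\<close>, \<open>X\<^sub>1X\<^sub>4 - X\<^sub>2X\<^sub>3\<close> and \<open>X\<^sub>2X\<^sub>4 - X\<^sub>3\<^sup>2\<close>; they are the coordinates in \<open>syzygy\<close> below.
\<close>

definition syzygies :: "tensor set" where
  "syzygies = {\<delta>. transpose \<delta> = \<delta> \<and> mult_map \<delta> = (\<lambda>x. 0)}"

definition syzygy :: "real^3 \<Rightarrow> tensor" where
  "syzygy u = vector [vector [0, 0, u$1, u$2], vector [0, - 2 * u$1, - u$2, u$3],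
     vector [u$1, - u$2, - 2 * u$3, 0], vector [u$2, u$3, 0, 0]]"

lemma mult_map_zero_iff: "mult_map \<delta> = (\<lambda>x. 0) \<longleftrightarrow> dehomog \<delta> = 0"
proof -
  have "mult_map (0::tensor) = (\<lambda>x. 0)" "dehomog 0 = 0"
    by (simp_all add: mult_map_def dehomog_def fun_eq_iff)
  then show ?thesis
    using mult_map_eq_iff[of \<delta> 0] by simp
qed

lemma syzygies_eq_range: "syzygies = range syzygy"
proof
  show "syzygies \<subseteq> range syzygy"
  proof
    fix \<delta> assume "\<delta> \<in> syzygies"
    then have s: "\<And>i j. \<delta>$i$j = \<delta>$j$i" and z: "dehomog \<delta> = 0"
      by (auto simp: syzygies_def mult_map_zero_iff transpose_def vec_eq_iff)
    have "\<delta> = syzygy (vector [\<delta>$1$3, \<delta>$1$4, \<delta>$2$4])"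
      using z s[of 2 1] s[of 3 1] s[of 4 1] s[of 3 2] s[of 4 2] s[of 4 3]
      by (simp add: dehomog_def syzygy_def vec_eq_iff forall_4)
    then show "\<delta> \<in> range syzygy" by blast
  qed
  show "range syzygy \<subseteq> syzygies"
    by (auto simp: syzygies_def mult_map_zero_iff dehomog_def syzygy_def transpose_def
        vec_eq_iff forall_4)
qed

lemma linear_syzygy: "linear syzygy"
  by (rule linearI) (simp_all add: syzygy_def vec_eq_iff forall_4)

lemma inj_syzygy: "inj syzygy"
  by (rule injI) (simp add: syzygy_def vec_eq_iff forall_4 forall_3)

lemma subspace_syzygies: "subspace syzygies"
  unfolding syzygies_eq_range by (intro linear_subspace_image linear_syzygy subspace_UNIV)

lemma dim_syzygies: "dim syzygies = 3"
  unfolding syzygies_eq_range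
  using dim_image_eq[OF linear_syzygy, of UNIV] inj_syzygy by simp

text \<open>
  A quadric through the twisted cubic is singular only at points of the twisted cubic. This is
  the dual form of the fact that, for a three-dimensional space \<open>U\<close> of cubics without common
  zero, multiplication is injective on \<open>S\<^sub>2U\<close>: the vector \<open>v\<close> is the functional that cuts out \<open>U\<close>, and
  it lies on the twisted cubic exactly if it is, up to a scalar, evaluation at a real point, which
  is then a common zero of \<open>U\<close>. With \<open>u = (a, b, c)\<close>, the kernel is trivial unless \<open>b\<^sup>2 = a c\<close>, and
  then it is spanned by the point of the twisted cubic with parameters \<open>(-b, a)\<close>, or \<open>(1, 0)\<close>
  if \<open>a = b = 0\<close>.
\<close>

lemma syzygy_kernel:
  assumes "syzygy u *v v = 0" "u \<noteq> 0" "v \<noteq> 0"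
  shows "\<exists>x k. x \<noteq> 0 \<and> k \<noteq> 0 \<and> v = k *\<^sub>R cubic_monomial x"
proof -
  define a b c where abc: "a = u$1" "b = u$2" "c = u$3"
  define p q r s where pqrs: "p = v$1" "q = v$2" "r = v$3" "s = v$4"
  have e: "a * r + b * s = 0" "2 * a * q + b * r - c * s = 0"
    "a * p - b * q - 2 * c * r = 0" "b * p + c * q = 0"
    using assms(1)
    by (simp_all add: vec_eq_iff forall_4 syzygy_def matrix_vector_mult_def sum_4 abc pqrs
        algebra_simps)
  have u0: "a \<noteq> 0 \<or> b \<noteq> 0 \<or> c \<noteq> 0" and v0: "p \<noteq> 0 \<or> q \<noteq> 0 \<or> r \<noteq> 0 \<or> s \<noteq> 0"
    using assms(2,3) by (auto simp: vec_eq_iff forall_4 forall_3 abc pqrs)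
  have pt: ?thesis if "m \<noteq> 0 \<or> n \<noteq> 0" "k \<noteq> 0" "p = k * m^3" "q = k * (m^2 * n)"
      "r = k * (m * n^2)" "s = k * n^3" for m n k
    using that
    by (intro exI[of _ "vector [m, n]"] exI[of _ k])
       (auto simp: vec_eq_iff forall_4 forall_2 cubic_monomial_def pqrs)
  show ?thesis
  proof (cases "b = 0")
    case True
    then have e': "a * r = 0" "2 * a * q = c * s" "a * p = 2 * c * r" "c * q = 0"
      using e by auto
    show ?thesis
    proof (cases "a = 0")
      case a: True
      then have "c \<noteq> 0" using u0 True by simp
      then show ?thesis using pt[of 1 0 p] v0 e'(2-4) a by simp
    next
      case a: False
      then have r: "r = 0" and p: "p = 0" using e' by auto
      have q: "q = 0" using a e'(2,4) by auto
      then show ?thesis using pt[of 0 1 s] v0 r p by simp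
    qed
  next
    case b: False
    have s: "s = - a * r / b" and p: "p = - c * q / b"
      using e b by (simp_all add: field_simps)
    have f1: "2 * a * b * q + (b\<^sup>2 + a * c) * r = 0"
      using e(2) b by (simp add: s field_simps power2_eq_square)
    have f2: "(b\<^sup>2 + a * c) * q + 2 * b * c * r = 0"
      using e(3) b by (simp add: p field_simps power2_eq_square)
    \<comment> \<open>A linear system for \<open>(q, r)\<close> with determinant \<open>- (b\<^sup>2 - a c)\<^sup>2\<close>.\<close>
    have "(b\<^sup>2 - a * c)\<^sup>2 * q = 0" "(b\<^sup>2 - a * c)\<^sup>2 * r = 0"
      using f1 f2 by algebra+
    moreover have "q \<noteq> 0 \<or> r \<noteq> 0"
      using v0 s p by auto
    ultimately have ac: "b\<^sup>2 = a * c" by auto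
    then have a: "a \<noteq> 0" using b by auto
    have c: "c = b\<^sup>2 / a" using ac a by (simp add: field_simps)
    have q: "q = - b * r / a"
    proof -
      have "2 * b * (a * q + b * r) = 0"
        using f1 ac by algebra
      then have "a * q + b * r = 0" using b by (simp only: mult_eq_0_iff) simp
      then have "a * q = - (b * r)" by simp
      then show ?thesis using a by (metis nonzero_mult_div_cancel_left mult_minus_left)
    qed
    have r: "r \<noteq> 0" using q \<open>q \<noteq> 0 \<or> r \<noteq> 0\<close> by auto
    \<comment> \<open>The scalar is read off from the third coordinate, \<open>r = k m n\<^sup>2\<close> with \<open>(m, n) = (-b, a)\<close>.\<close>
    show ?thesis
      using a b r
      by (intro pt[of "- b" a "- r / (a\<^sup>2 * b)"])
        (simp_all add: p q s c field_simps power2_eq_square power3_eq_cube)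
  qed
qed

section \<open>Ranks and faces\<close>

lemma Gram_iff: "\<theta> \<in> Gram f \<longleftrightarrow> psd \<theta> \<and> mult_map \<theta> = f"
  by (simp add: Gram_def S2V_plus_iff_psd)

lemma convex_Gram: "convex (Gram f)"
proof (rule convexI)
  fix x y :: tensor and u v :: real
  assume "x \<in> Gram f" "y \<in> Gram f" "0 \<le> u" "0 \<le> v" "u + v = 1"
  then show "u *\<^sub>R x + v *\<^sub>R y \<in> Gram f"
    by (auto simp: Gram_iff psd_add psd_scaleR fun_eq_iff mult_map_add mult_map_scaleR
        distrib_right[symmetric])
qed

lemma Gram_diff: "\<theta> \<in> Gram f \<Longrightarrow> \<eta> \<in> Gram f \<Longrightarrow> \<theta> - \<eta> \<in> syzygies"
  using mult_map_add[of "\<theta> - \<eta>" \<eta>]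
  by (auto simp: Gram_iff psd_def syzygies_def transpose_minus fun_eq_iff)

text \<open>
  Let \<open>\<theta>\<close> lie strictly between \<open>a\<close> and \<open>b\<close>, and let \<open>v \<noteq> 0\<close> be in its kernel. As \<open>a\<close> and \<open>b\<close> are
  positive semidefinite, both of them kill \<open>v\<close>, hence so does the syzygy \<open>a - b\<close>. If \<open>a \<noteq> b\<close>, then \<open>v\<close>
  is, up to a scalar, evaluation at a real point \<open>x\<close>, whence \<open>f x = 0\<close>, contrary to strict positivity.
\<close>

lemma extreme_if_rank_le_3:
  assumes f: "strictly_positive f" and \<theta>: "\<theta> \<in> Gram f" "rank \<theta> \<le> 3"
  shows "\<theta> extreme_point_of Gram f"
proof -
  have False if ab: "a \<in> Gram f" "b \<in> Gram f" and seg: "\<theta> \<in> open_segment a b" for a b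
  proof -
    from \<theta>(2) have "\<not> inj ((*v) \<theta>)"
      using full_rank_injective[of \<theta>] by simp
    then obtain v where v: "\<theta> *v v = 0" "v \<noteq> 0"
      using linear_injective_0[OF matrix_vector_mul_linear, of \<theta>] by auto
    from seg obtain t where "a \<noteq> b" and t: "0 < t" "t < 1" and \<theta>_eq: "\<theta> = (1 - t) *\<^sub>R a + t *\<^sub>R b"
      by (auto simp: in_segment)
    have nn: "0 \<le> v \<bullet> (a *v v)" "0 \<le> v \<bullet> (b *v v)"
      using ab by (auto simp: Gram_iff psd_def)
    have "(1 - t) * (v \<bullet> (a *v v)) + t * (v \<bullet> (b *v v)) = v \<bullet> (\<theta> *v v)"
      by (simp add: \<theta>_eq matrix_vector_mult_add_rdistrib scaleR_matrix_vector_assoc[symmetric]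
          inner_add_right)
    then have "(1 - t) * (v \<bullet> (a *v v)) + t * (v \<bullet> (b *v v)) = 0"
      using v by simp
    then have "v \<bullet> (a *v v) = 0" "v \<bullet> (b *v v) = 0"
      using nn t by (auto simp: add_nonneg_eq_0_iff)
    then have "a *v v = 0" "b *v v = 0"
      using ab psd_kernel by (auto simp: Gram_iff)
    then have "(a - b) *v v = 0"
      by (simp add: matrix_vector_mult_diff_rdistrib)
    moreover obtain u where u: "a - b = syzygy u"
      using Gram_diff[OF ab] by (auto simp: syzygies_eq_range)
    moreover have "u \<noteq> 0"
      using u \<open>a \<noteq> b\<close> linear_0[OF linear_syzygy] by auto
    ultimately obtain x k where x: "x \<noteq> 0" "k \<noteq> 0" "v = k *\<^sub>R cubic_monomial x"
      using syzygy_kernel v(2) by metis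
    have "\<theta> *v cubic_monomial x = 0"
      using v(1) x(2,3) by (simp add: matrix_vector_mult_scaleR)
    then have "f x = 0"
      using \<theta>(1) mult_map_inner[of \<theta> x] by (simp add: Gram_iff)
    then show False
      using f x(1) unfolding strictly_positive_def by (metis less_irrefl)
  qed
  then show ?thesis
    using \<theta>(1) by (auto simp: extreme_point_of_def)
qed

lemma pos_def_lower_bound:
  assumes "psd \<theta>" "rank \<theta> = 4"
  shows "\<exists>m>0. \<forall>x. m * (norm x)\<^sup>2 \<le> x \<bullet> (\<theta> *v x)"
proof -
  have cont: "continuous_on (sphere 0 1) (\<lambda>x. x \<bullet> (\<theta> *v x))"
    by (intro continuous_intros linear_continuous_on linear_linear[THEN iffD2]
        matrix_vector_mul_linear)
  have ne: "sphere (0::real^4) 1 \<noteq> {}"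
    by simp
  obtain x0 where x0: "norm x0 = 1" "\<And>x. norm x = 1 \<Longrightarrow> x0 \<bullet> (\<theta> *v x0) \<le> x \<bullet> (\<theta> *v x)"
    using continuous_attains_inf[OF compact_sphere ne cont] by auto
  let ?m = "x0 \<bullet> (\<theta> *v x0)"
  have "inj ((*v) \<theta>)"
    using assms(2) full_rank_injective[of \<theta>] by simp
  then have "\<theta> *v x0 \<noteq> 0"
    using x0(1) linear_injective_0[OF matrix_vector_mul_linear, of \<theta>] by auto
  then have "?m > 0"
    using assms(1) psd_kernel[OF assms(1), of x0] unfolding psd_def by (metis less_eq_real_def)
  moreover have "?m * (norm x)\<^sup>2 \<le> x \<bullet> (\<theta> *v x)" for x
  proof (cases "x = 0")
    case False
    have "?m \<le> ((1 / norm x) *\<^sub>R x) \<bullet> (\<theta> *v ((1 / norm x) *\<^sub>R x))"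
      using False by (intro x0(2)) simp
    then show ?thesis
      using False by (simp add: matrix_vector_mult_scaleR field_simps power2_eq_square)
  qed simp
  ultimately show ?thesis by blast
qed

text \<open>
  A tensor of full rank in \<open>Gram f\<close> is positive definite, so it stays in the cone after a small
  move in any direction, and moves along syzygies do not change its image under \<open>\<mu>\<close>.
\<close>

lemma Gram_perturb:
  assumes \<theta>: "\<theta> \<in> Gram f" "rank \<theta> = 4" and \<delta>: "\<delta> \<in> syzygies"
  shows "\<exists>\<epsilon>>0. \<forall>s. \<bar>s\<bar> \<le> \<epsilon> \<longrightarrow> \<theta> + s *\<^sub>R \<delta> \<in> Gram f"
proof -
  have p: "psd \<theta>" "mult_map \<theta> = f" using \<theta> by (auto simp: Gram_iff)
  obtain m where m: "m > 0" "\<And>x. m * (norm x)\<^sup>2 \<le> x \<bullet> (\<theta> *v x)"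
    using pos_def_lower_bound[OF p(1) \<theta>(2)] by blast
  define B where "B = onorm ((*v) \<delta>)"
  have bl: "bounded_linear ((*v) \<delta>)"
    by (simp add: linear_linear[THEN iffD2] matrix_vector_mul_linear)
  have B: "B \<ge> 0" "\<And>x. norm (\<delta> *v x) \<le> B * norm x"
    using onorm_pos_le[OF bl] onorm[OF bl] by (auto simp: B_def)
  have bd: "\<bar>x \<bullet> (\<delta> *v x)\<bar> \<le> B * (norm x)\<^sup>2" for x
  proof -
    have "\<bar>x \<bullet> (\<delta> *v x)\<bar> \<le> norm x * norm (\<delta> *v x)"
      by (rule Cauchy_Schwarz_ineq2)
    also have "\<dots> \<le> norm x * (B * norm x)"
      by (intro mult_left_mono B) simp
    finally show ?thesis by (simp add: power2_eq_square algebra_simps)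
  qed
  have "\<theta> + s *\<^sub>R \<delta> \<in> Gram f" if s: "\<bar>s\<bar> \<le> m / (B + 1)" for s
  proof -
    have "\<bar>s\<bar> * B \<le> m / (B + 1) * (B + 1)"
      using s B(1) by (intro mult_mono) auto
    then have sB: "\<bar>s\<bar> * B \<le> m" using B(1) by simp
    have "0 \<le> x \<bullet> ((\<theta> + s *\<^sub>R \<delta>) *v x)" for x
    proof -
      have "\<bar>s * (x \<bullet> (\<delta> *v x))\<bar> \<le> \<bar>s\<bar> * (B * (norm x)\<^sup>2)"
        unfolding abs_mult by (intro mult_left_mono bd) simp
      also have "\<dots> \<le> m * (norm x)\<^sup>2"
        using mult_right_mono[OF sB, of "(norm x)\<^sup>2"] by (simp add: mult.assoc)
      also have "\<dots> \<le> x \<bullet> (\<theta> *v x)" by (rule m)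
      finally show ?thesis
        by (simp add: matrix_vector_mult_add_rdistrib scaleR_matrix_vector_assoc[symmetric]
            inner_add_right)
    qed
    then have "psd (\<theta> + s *\<^sub>R \<delta>)"
      using p(1) \<delta> by (simp add: psd_def syzygies_def transpose_plus transpose_scaleR)
    moreover have "mult_map (\<theta> + s *\<^sub>R \<delta>) = f"
      using p(2) \<delta> by (auto simp: mult_map_add mult_map_scaleR syzygies_def)
    ultimately show ?thesis by (simp add: Gram_iff)
  qed
  moreover have "m / (B + 1) > 0" using m(1) B(1) by simp
  ultimately show ?thesis by blast
qed

lemma aff_dim_Gram:
  assumes "\<theta> \<in> Gram f" "rank \<theta> = 4"
  shows "aff_dim (Gram f) = 3"
proof -
  have "affine hull (Gram f) = (+) \<theta> ` syzygies"
  proof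
    have "Gram f \<subseteq> (+) \<theta> ` syzygies"
    proof
      fix \<eta> assume "\<eta> \<in> Gram f"
      then have "\<eta> - \<theta> \<in> syzygies" using assms Gram_diff by blast
      then show "\<eta> \<in> (+) \<theta> ` syzygies" by (rule rev_image_eqI) simp
    qed
    then show "affine hull (Gram f) \<subseteq> (+) \<theta> ` syzygies"
      by (intro hull_minimal) (simp_all add: affine_translation[symmetric] subspace_imp_affine
          subspace_syzygies)
    show "(+) \<theta> ` syzygies \<subseteq> affine hull (Gram f)"
    proof clarify
      fix \<delta> assume "\<delta> \<in> syzygies"
      then obtain \<epsilon> where \<epsilon>: "\<epsilon> > 0" "\<theta> + \<epsilon> *\<^sub>R \<delta> \<in> Gram f"
        using Gram_perturb[OF assms] by (metis abs_of_pos order_refl)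
      then have "(1 - 1 / \<epsilon>) *\<^sub>R \<theta> + (1 / \<epsilon>) *\<^sub>R (\<theta> + \<epsilon> *\<^sub>R \<delta>) \<in> affine hull (Gram f)"
        using assms by (intro mem_affine[OF affine_affine_hull]) (auto intro: hull_inc)
      moreover have "(1 - 1 / \<epsilon>) *\<^sub>R \<theta> + (1 / \<epsilon>) *\<^sub>R (\<theta> + \<epsilon> *\<^sub>R \<delta>) = \<theta> + \<delta>"
        using \<epsilon>(1) by (simp add: algebra_simps)
      ultimately show "\<theta> + \<delta> \<in> affine hull (Gram f)" by simp
    qed
  qed
  then have "aff_dim (Gram f) = aff_dim ((+) \<theta> ` syzygies)"
    by (metis aff_dim_affine_hull)
  then show ?thesis
    by (simp add: aff_dim_translation_eq aff_dim_subspace subspace_syzygies dim_syzygies)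
qed

text \<open>
  From a point of full rank one can move a little beyond it, away from any other point \<open>\<eta>\<close> of
  \<open>Gram f\<close>; so the point lies in an open segment with \<open>\<eta>\<close> as an endpoint.
\<close>

lemma face_with_rank_4:
  assumes F: "F face_of Gram f" and \<theta>: "\<theta> \<in> F" "rank \<theta> = 4"
  shows "F = Gram f"
proof
  show "F \<subseteq> Gram f" using F by (rule face_of_imp_subset)
  then have \<theta>G: "\<theta> \<in> Gram f" using \<theta> by blast
  show "Gram f \<subseteq> F"
  proof
    fix \<eta> assume \<eta>: "\<eta> \<in> Gram f"
    show "\<eta> \<in> F"
    proof (cases "\<eta> = \<theta>")
      case False
      obtain \<epsilon> where \<epsilon>: "\<epsilon> > 0" "\<And>s. \<bar>s\<bar> \<le> \<epsilon> \<Longrightarrow> \<theta> + s *\<^sub>R (\<eta> - \<theta>) \<in> Gram f"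
        using Gram_perturb[OF \<theta>G \<theta>(2) Gram_diff[OF \<eta> \<theta>G]] by blast
      define \<zeta> where "\<zeta> = \<theta> + (- \<epsilon>) *\<^sub>R (\<eta> - \<theta>)"
      have \<zeta>: "\<zeta> \<in> Gram f" unfolding \<zeta>_def using \<epsilon>(1) by (intro \<epsilon>(2)) simp
      have "(1 + \<epsilon>) *\<^sub>R \<theta> = \<zeta> + \<epsilon> *\<^sub>R \<eta>"
        by (simp add: \<zeta>_def algebra_simps)
      then have "\<theta> = (1 / (1 + \<epsilon>)) *\<^sub>R (\<zeta> + \<epsilon> *\<^sub>R \<eta>)"
        using \<epsilon>(1) by (metis add_pos_pos less_irrefl zero_less_one scaleR_scaleR
            nonzero_eq_divide_eq scaleR_one mult.commute)
      also have "\<dots> = (1 - \<epsilon> / (1 + \<epsilon>)) *\<^sub>R \<zeta> + (\<epsilon> / (1 + \<epsilon>)) *\<^sub>R \<eta>"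
        using \<epsilon>(1) by (simp add: scaleR_add_right field_simps)
      finally have eq: "\<theta> = (1 - \<epsilon> / (1 + \<epsilon>)) *\<^sub>R \<zeta> + (\<epsilon> / (1 + \<epsilon>)) *\<^sub>R \<eta>" .
      have "\<zeta> \<noteq> \<eta>"
      proof
        assume "\<zeta> = \<eta>"
        then have "\<theta> = \<eta>" using eq by (simp add: scaleR_left_distrib[symmetric])
        then show False using False by simp
      qed
      then have "\<theta> \<in> open_segment \<zeta> \<eta>"
        unfolding in_segment using eq \<epsilon>(1)
        by (intro conjI exI[of _ "\<epsilon> / (1 + \<epsilon>)"]) simp_all
      then show ?thesis
        using face_ofD[OF F _ \<zeta> \<eta> \<theta>(1)] by blast
    qed (use \<theta> in simp)
  qed
qed

text \<open>
  Midpoints are never extreme, so they cannot have rank at most three. This yields points of rank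
  four as soon as \<open>Gram f\<close> has two elements.
\<close>

lemma midpoint_rank_4:
  assumes "strictly_positive f" "\<theta> \<in> Gram f" "\<eta> \<in> Gram f" "\<theta> \<noteq> \<eta>"
  shows "midpoint \<theta> \<eta> \<in> Gram f" "rank (midpoint \<theta> \<eta>) = 4"
proof -
  show G: "midpoint \<theta> \<eta> \<in> Gram f"
    using assms convex_Gram[of f] by (simp add: convex_contains_segment)
        (metis midpoint_in_closed_segment subsetD)
  have "\<not> midpoint \<theta> \<eta> extreme_point_of Gram f"
    using assms(2-4) midpoint_in_open_segment[of \<theta> \<eta>]
    unfolding extreme_point_of_def by blast
  then have "\<not> rank (midpoint \<theta> \<eta>) \<le> 3"
    using extreme_if_rank_le_3[OF assms(1) G] by blast
  then show "rank (midpoint \<theta> \<eta>) = 4"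
    using rank_bound[of "midpoint \<theta> \<eta>"] by simp
qed

section \<open>Factorization over the complex numbers\<close>

definition cubic_with_roots :: "complex \<Rightarrow> complex \<Rightarrow> complex \<Rightarrow> complex poly" where
  "cubic_with_roots z1 z2 z3 = [:-z1,1:] * [:-z2,1:] * [:-z3,1:]"

lemma poly_linear_factor: "poly ([:-z,1:] * H) x = (x - z) * poly (H :: complex poly) x"
  by (simp add: algebra_simps)

lemma poly_cubic_with_roots:
  "poly (cubic_with_roots z1 z2 z3) x = (x - z1) * (x - z2) * (x - z3)"
  by (simp add: cubic_with_roots_def algebra_simps)

lemma map_poly_of_real_mult:
  "map_poly complex_of_real (p * q) = map_poly complex_of_real p * map_poly complex_of_real q"
  by (rule poly_eqI) (simp add: coeff_map_poly coeff_mult)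

lemma poly_map_of_real: "poly (map_poly complex_of_real p) (of_real t) = of_real (poly p t)"
  by (induction p) (simp_all add: map_poly_pCons)

text \<open>
  A nonreal root \<open>w\<close> exists by the fundamental theorem of algebra. The remainder of \<open>F\<close> modulo
  the real quadratic with roots \<open>w\<close> and \<open>cnj w\<close> has degree at most one and vanishes at \<open>w\<close>; having
  real coefficients, it is zero.
\<close>

lemma split_off_conjugate_roots:
  fixes F :: "real poly"
  assumes deg: "degree F \<noteq> 0" and noroot: "\<And>t. poly F t \<noteq> 0"
  shows "\<exists>z D. Im z > 0 \<and> degree F = degree D + 2
    \<and> (\<forall>t. poly F t = (cmod (of_real t - z))\<^sup>2 * poly D t)"
proof -
  let ?C = "map_poly complex_of_real"
  have "degree (?C F) \<noteq> 0"
    using deg by (simp add: degree_map_poly)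
  then have "\<not> constant (poly (?C F))"
    by (simp add: constant_degree)
  then obtain w where w: "poly (?C F) w = 0"
    using fundamental_theorem_of_algebra by blast
  have Imw: "Im w \<noteq> 0"
  proof
    assume "Im w = 0"
    then have "w = of_real (Re w)" by (simp add: complex_eq_iff)
    then show False
      using w noroot[of "Re w"] by (metis poly_map_of_real of_real_eq_0_iff)
  qed
  define Q where "Q = [:(cmod w)\<^sup>2, - 2 * Re w, 1:]"
  have Q: "poly Q t = (cmod (of_real t - w))\<^sup>2" for t
    unfolding Q_def cmod_power2 by (simp add: power2_eq_square algebra_simps)
  have "poly (?C Q) w = (of_real (cmod w))\<^sup>2 - 2 * of_real (Re w) * w + w * w"
    by (simp add: Q_def map_poly_pCons algebra_simps)
  also have "\<dots> = 0"
    unfolding of_real_power[symmetric] cmod_power2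
    by (simp add: complex_eq_iff power2_eq_square algebra_simps)
  finally have Qw: "poly (?C Q) w = 0" .
  define D R where "D = F div Q" and "R = F mod Q"
  have FDR: "F = Q * D + R" by (simp add: D_def R_def)
  have Q0: "Q \<noteq> 0" "degree Q = 2" by (simp_all add: Q_def)
  have "R = 0 \<or> degree R < degree Q"
    unfolding R_def by (rule degree_mod_less[OF Q0(1)])
  then have "degree R < 2" using Q0 by auto
  then have R: "R = [:coeff R 0, coeff R 1:]"
    by (intro poly_eqI) (auto simp: coeff_pCons coeff_eq_0 split: nat.split)
  have "?C F = ?C Q * ?C D + ?C R"
    by (subst FDR) (simp add: map_poly_of_real_mult[symmetric] poly_eq_iff coeff_map_poly)
  then have "poly (?C R) w = 0"
    using w Qw by simp
  moreover have "poly (?C R) w = of_real (coeff R 0) + w * of_real (coeff R 1)"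
    by (subst R) (simp add: map_poly_pCons)
  ultimately have "coeff R 0 + Re w * coeff R 1 = 0" "Im w * coeff R 1 = 0"
    by (simp_all add: complex_eq_iff)
  then have "R = 0" using Imw by (subst R) simp
  then have F: "F = Q * D" using FDR by simp
  have "D \<noteq> 0" using F deg by auto
  then have degF: "degree F = degree D + 2"
    using F Q0 by (simp add: degree_mult_eq)
  define z where "z = (if Im w > 0 then w else cnj w)"
  have "Im z > 0" using Imw by (simp add: z_def)
  moreover have "cmod (of_real t - z) = cmod (of_real t - w)" for t
    by (simp add: z_def cmod_def)
  then have "poly F t = (cmod (of_real t - z))\<^sup>2 * poly D t" for t
    by (simp add: F Q)
  ultimately show ?thesis using degF by blast
qed

lemma cmod_minus_pos: "Im z > 0 \<Longrightarrow> 0 < (cmod (of_real t - z))\<^sup>2"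
  by (auto simp: complex_eq_iff)

lemma positive_sextic_factorization:
  fixes F :: "real poly"
  assumes deg: "degree F = 6" and pos: "\<And>t. poly F t > 0"
  shows "\<exists>c z1 z2 z3. c > 0 \<and> Im z1 > 0 \<and> Im z2 > 0 \<and> Im z3 > 0 \<and>
    (\<forall>t. poly F t = (cmod (poly (smult (of_real c) (cubic_with_roots z1 z2 z3)) (of_real t)))\<^sup>2)"
proof -
  have step: "\<exists>z D. Im z > 0 \<and> degree G = degree D + 2 \<and> (\<forall>t. poly D t > 0)
      \<and> (\<forall>t. poly G t = (cmod (of_real t - z))\<^sup>2 * poly D t)"
    if G: "degree G \<noteq> 0" "\<And>t. poly G t > 0" for G :: "real poly"
  proof -
    have "poly G t \<noteq> 0" for t using G(2)[of t] by simp
    from split_off_conjugate_roots[OF G(1) this] obtain z D where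
      z: "Im z > 0" "degree G = degree D + 2" "\<And>t. poly G t = (cmod (of_real t - z))\<^sup>2 * poly D t"
      by blast
    have "poly D t > 0" for t
      using G(2)[of t] z(3)[of t] cmod_minus_pos[OF z(1), of t] by (simp add: zero_less_mult_iff)
    then show ?thesis using z by blast
  qed
  obtain z1 F1 where 1: "Im z1 > 0" "degree F = degree F1 + 2" "\<And>t. poly F1 t > 0"
      "\<And>t. poly F t = (cmod (of_real t - z1))\<^sup>2 * poly F1 t"
    using step[of F] deg pos by auto
  obtain z2 F2 where 2: "Im z2 > 0" "degree F1 = degree F2 + 2" "\<And>t. poly F2 t > 0"
      "\<And>t. poly F1 t = (cmod (of_real t - z2))\<^sup>2 * poly F2 t"
    using step[of F1] 1 deg by auto
  obtain z3 F3 where 3: "Im z3 > 0" "degree F2 = degree F3 + 2" "\<And>t. poly F3 t > 0"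
      "\<And>t. poly F2 t = (cmod (of_real t - z3))\<^sup>2 * poly F3 t"
    using step[of F2] 1 2 deg by auto
  have "degree F3 = 0" using 1 2 3 deg by simp
  then obtain a where a: "F3 = [:a:]" by (rule degree_eq_zeroE)
  have "a > 0" using 3(3)[of 0] a by simp
  have *: "poly F t = (cmod (poly (smult (of_real (sqrt a)) (cubic_with_roots z1 z2 z3)) (of_real t)))\<^sup>2" for t
    using \<open>a > 0\<close> by (simp add: 1 2 3 a poly_cubic_with_roots norm_mult power_mult_distrib)
  show ?thesis
    using \<open>a > 0\<close> 1(1) 2(1) 3(1) *
    by (intro exI[of _ "sqrt a"] exI[of _ z1] exI[of _ z2] exI[of _ z3]) simp
qed

lemma complex_poly_eq_on_reals:
  fixes p q :: "complex poly"
  assumes "\<And>t :: real. poly p (of_real t) = poly q (of_real t)"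
  shows "p = q"
proof (rule ccontr)
  assume "p \<noteq> q"
  then have "finite {x. poly (p - q) x = 0}"
    by (intro poly_roots_finite) simp
  moreover have "range complex_of_real \<subseteq> {x. poly (p - q) x = 0}"
    using assms by auto
  ultimately have "finite (range complex_of_real)"
    by (rule finite_subset[rotated])
  then show False
    using finite_imageD[of complex_of_real UNIV] infinite_UNIV_char_0 by (auto simp: inj_on_def)
qed

text \<open>
  Equality of absolute values on the real line means that \<open>G\<close> times its conjugate polynomial
  equals the same product for the other side, as polynomials. So \<open>z\<close> is a root of \<open>G\<close> or of its
  conjugate. The corresponding linear factor cancels, because \<open>\<bar>t - z\<bar> = \<bar>t - cnj z\<bar> \<noteq> 0\<close> for
  real \<open>t\<close>.
\<close>

lemma peel_root:
  fixes G H :: "complex poly"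
  assumes eq: "\<And>t::real. cmod (poly G (of_real t)) = cmod (poly ([:-z,1:] * H) (of_real t))"
    and z: "Im z > 0"
  shows "\<exists>w G1. w \<in> {z, cnj z} \<and> G = [:-w,1:] * G1
    \<and> (\<forall>t::real. cmod (poly G1 (of_real t)) = cmod (poly H (of_real t)))"
proof -
  let ?H = "[:-z,1:] * H"
  have "G * map_poly cnj G = ?H * map_poly cnj ?H"
    by (rule complex_poly_eq_on_reals)
      (simp only: poly_mult poly_map_poly_cnj complex_cnj_complex_of_real
        complex_norm_square[symmetric] eq)
  then have "poly (G * map_poly cnj G) z = 0"
    by simp
  then have "poly G z = 0 \<or> poly G (cnj z) = 0" by simp
  then obtain w where w: "w \<in> {z, cnj z}" "poly G w = 0" by blast
  then obtain G1 where G1: "G = [:-w,1:] * G1"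
    by (auto simp: poly_eq_0_iff_dvd elim: dvdE)
  have "cmod (poly G1 (of_real t)) = cmod (poly H (of_real t))" for t
  proof -
    have "cmod (of_real t - w) = cmod (of_real t - z)"
      using w(1) by (auto simp: cmod_def)
    moreover have "cmod (of_real t - z) \<noteq> 0"
      using cmod_minus_pos[OF z, of t] by auto
    ultimately show ?thesis
      using eq[of t] unfolding G1 poly_linear_factor norm_mult by simp
  qed
  then show ?thesis using w(1) G1 by blast
qed

lemma equal_modulus_cubic:
  fixes G :: "complex poly"
  assumes eq: "\<And>t::real. cmod (poly G (of_real t))
      = cmod (poly (smult (of_real c) (cubic_with_roots z1 z2 z3)) (of_real t))"
    and Im: "Im z1 > 0" "Im z2 > 0" "Im z3 > 0" and c: "c > 0" and deg: "degree G \<le> 3"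
  shows "\<exists>u w1 w2 w3. cmod u = c \<and> w1 \<in> {z1, cnj z1} \<and> w2 \<in> {z2, cnj z2} \<and> w3 \<in> {z3, cnj z3}
    \<and> G = smult u (cubic_with_roots w1 w2 w3)"
proof -
  have "\<And>t::real. cmod (poly G (of_real t))
      = cmod (poly ([:-z1,1:] * ([:-z2,1:] * ([:-z3,1:] * [:of_real c:]))) (of_real t))"
    unfolding eq poly_smult poly_cubic_with_roots poly_linear_factor by (simp add: mult_ac)
  from peel_root[OF this Im(1)] obtain w1 G1 where 1: "w1 \<in> {z1, cnj z1}" "G = [:-w1,1:] * G1"
    "\<And>t::real. cmod (poly G1 (of_real t)) = cmod (poly ([:-z2,1:] * ([:-z3,1:] * [:of_real c:])) (of_real t))"
    by blast
  from peel_root[OF 1(3) Im(2)] obtain w2 G2 where 2: "w2 \<in> {z2, cnj z2}" "G1 = [:-w2,1:] * G2"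
    "\<And>t::real. cmod (poly G2 (of_real t)) = cmod (poly ([:-z3,1:] * [:of_real c:]) (of_real t))"
    by blast
  from peel_root[OF 2(3) Im(3)] obtain w3 G3 where 3: "w3 \<in> {z3, cnj z3}" "G2 = [:-w3,1:] * G3"
    "\<And>t::real. cmod (poly G3 (of_real t)) = cmod (poly [:of_real c:] (of_real t))"
    by blast
  have "G3 \<noteq> 0" using 3(3)[of 0] c by auto
  then have "degree G = degree G3 + 3"
    using 1(2) 2(2) 3(2) by (simp add: degree_mult_eq del: mult_pCons_left)
  then have "degree G3 = 0" using deg by simp
  then obtain u where u: "G3 = [:u:]" by (rule degree_eq_zeroE)
  have "cmod u = c" using 3(3)[of 0] c by (simp add: u)
  moreover have "G = smult u (cubic_with_roots w1 w2 w3)"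
    unfolding 1(2) 2(2) 3(2) u cubic_with_roots_def by (simp add: algebra_simps)
  ultimately show ?thesis using 1(1) 2(1) 3(1) by blast
qed

section \<open>Gram tensors of rank at most two\<close>

definition coeff_vec :: "complex poly \<Rightarrow> complex^4" where
  "coeff_vec G = vector [coeff G 3, coeff G 2, coeff G 1, coeff G 0]"

text \<open>
  For \<open>G = p + i q\<close> with real cubics \<open>p\<close> and \<open>q\<close> (dehomogenized) this is the tensor \<open>p \<otimes> p + q \<otimes> q\<close>,
  written as the real part of the Hermitian tensor of \<open>G\<close> so that its invariance under scalars
  of absolute value one and under conjugation is visible.
\<close>

definition Gram_of :: "complex poly \<Rightarrow> tensor" where
  "Gram_of G = (\<chi> i j. Re (coeff_vec G $ i * cnj (coeff_vec G $ j)))"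

lemma Gram_of_eq_squares:
  "Gram_of G = tensor_prod (\<chi> i. Re (coeff_vec G $ i)) (\<chi> i. Re (coeff_vec G $ i))
    + tensor_prod (\<chi> i. Im (coeff_vec G $ i)) (\<chi> i. Im (coeff_vec G $ i))"
  by (simp add: Gram_of_def tensor_prod_def vec_eq_iff)

lemma sum_of_two_squares_Gram_of:
  "\<exists>G. degree G \<le> 3 \<and> tensor_prod p p + tensor_prod q q = Gram_of G"
proof -
  let ?G = "[:Complex (p$4) (q$4), Complex (p$3) (q$3), Complex (p$2) (q$2), Complex (p$1) (q$1):]"
  have "tensor_prod p p + tensor_prod q q = Gram_of ?G"
    by (simp add: Gram_of_def tensor_prod_def vec_eq_iff forall_4 coeff_vec_def eval_nat_numeral)
  moreover have "degree ?G \<le> 3"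
    by simp
  ultimately show ?thesis by blast
qed

lemma psd_Gram_of: "psd (Gram_of G)"
  unfolding Gram_of_eq_squares by (intro psd_add psd_tensor_square)

lemma rank_Gram_of: "rank (Gram_of G) \<le> 2"
proof -
  define p q where "p = (\<chi> i. Re (coeff_vec G $ i))" and "q = (\<chi> i. Im (coeff_vec G $ i))"
  have "Gram_of G *v x = (p \<bullet> x) *\<^sub>R p + (q \<bullet> x) *\<^sub>R q" for x
    by (simp add: Gram_of_eq_squares matrix_vector_mult_add_rdistrib tensor_prod_mv p_def q_def)
  then have "range ((*v) (Gram_of G)) \<subseteq> span {p, q}"
    by (auto intro!: span_add span_scale intro: span_base)
  then have "rank (Gram_of G) \<le> dim {p, q}"
    unfolding rank_dim_range by (metis dim_subset dim_span)
  also have "\<dots> \<le> card {p, q}" by (rule dim_le_card') simp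
  also have "\<dots> \<le> 2" by (simp add: card_insert_if)
  finally show ?thesis .
qed

text \<open>
  For \<open>G = p + i q\<close>, this is \<open>p\<^sup>2 + q\<^sup>2 = \<bar>G\<bar>\<^sup>2\<close> on the real line.
\<close>

lemma mult_map_Gram_of:
  assumes "degree G \<le> 3"
  shows "mult_map (Gram_of G) (vector [t, 1]) = (cmod (poly G (of_real t)))\<^sup>2"
proof -
  have "poly G (of_real t) = (\<Sum>i\<le>3. coeff G i * of_real t ^ i)"
  proof -
    have "G = (\<Sum>i\<le>3. monom (coeff G i) i)"
      using assms by (metis poly_as_sum_of_monoms')
    then have "poly G (of_real t) = poly (\<Sum>i\<le>3. monom (coeff G i) i) (of_real t)" by simp
    then show ?thesis by (simp add: poly_sum poly_monom)
  qed
  then have "poly G (of_real t) =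
      coeff G 0 + coeff G 1 * of_real t + coeff G 2 * of_real (t^2) + coeff G 3 * of_real (t^3)"
    by (simp add: eval_nat_numeral)
  then have "Re (poly G (of_real t)) = Re (coeff G 0) + Re (coeff G 1) * t + Re (coeff G 2) * t^2 + Re (coeff G 3) * t^3"
    and "Im (poly G (of_real t)) = Im (coeff G 0) + Im (coeff G 1) * t + Im (coeff G 2) * t^2 + Im (coeff G 3) * t^3"
    by (simp_all del: of_real_power)
  then show ?thesis
    by (simp add: Gram_of_eq_squares mult_map_add mult_map_tensor_prod cubic_expand coeff_vec_def
        cmod_power2 power2_eq_square[of "_ + _"] algebra_simps)
qed

lemma Gram_of_smult: "Gram_of (smult u G) = (cmod u)\<^sup>2 *\<^sub>R Gram_of G"
proof -
  have "coeff_vec (smult u G) $ i = u * coeff_vec G $ i" for i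
    using exhaust_4[of i] by (auto simp: coeff_vec_def)
  moreover have "Re ((u * a) * cnj (u * b)) = (cmod u)\<^sup>2 * Re (a * cnj b)" for a b
    unfolding cmod_power2 by (simp add: power2_eq_square algebra_simps)
  ultimately show ?thesis
    by (simp add: Gram_of_def vec_eq_iff del: complex_cnj_mult)
qed

lemma Gram_of_cnj: "Gram_of (map_poly cnj G) = Gram_of G"
proof -
  have "coeff_vec (map_poly cnj G) $ i = cnj (coeff_vec G $ i)" for i
    using exhaust_4[of i] by (auto simp: coeff_vec_def coeff_map_poly)
  then show ?thesis
    by (simp add: Gram_of_def vec_eq_iff)
qed

lemma cnj_cubic_with_roots:
  "map_poly cnj (cubic_with_roots z1 z2 z3) = cubic_with_roots (cnj z1) (cnj z2) (cnj z3)"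
  by (rule complex_poly_eq_on_reals) (simp add: cubic_with_roots_def)

lemma degree_cubic_with_roots: "degree (cubic_with_roots z1 z2 z3) \<le> 3"
  by (simp add: cubic_with_roots_def)

text \<open>
  The diagonal entry of the second monomial is \<open>\<bar>z1 + z2 + z3\<bar>\<^sup>2\<close>. Conjugating \<open>z3\<close> preserves the
  real part of the root sum, but makes its imaginary part strictly smaller in absolute value.
\<close>

lemma Gram_of_cubic_distinct:
  assumes "Im z1 > 0" "Im z2 > 0" "Im z3 > 0"
  shows "Gram_of (cubic_with_roots z1 z2 z3) \<noteq> Gram_of (cubic_with_roots z1 z2 (cnj z3))"
proof
  assume "Gram_of (cubic_with_roots z1 z2 z3) = Gram_of (cubic_with_roots z1 z2 (cnj z3))"
  then have "Gram_of (cubic_with_roots z1 z2 z3) $ 2 $ 2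
      = Gram_of (cubic_with_roots z1 z2 (cnj z3)) $ 2 $ 2" by simp
  then have "(Im z1 + Im z2 + Im z3)\<^sup>2 = (Im z1 + Im z2 - Im z3)\<^sup>2"
    by (simp add: Gram_of_def coeff_vec_def cubic_with_roots_def eval_nat_numeral algebra_simps)
  then have "(Im z1 + Im z2) * Im z3 = 0"
    by (simp add: power2_eq_square algebra_simps)
  then show False using assms by auto
qed

lemma dehomog_of_Sigma6:
  assumes f: "f \<in> Sigma6" "strictly_positive f"
  shows "\<exists>\<theta>. mult_map \<theta> = f \<and> degree (dehomog \<theta>) = 6 \<and> (\<forall>t. poly (dehomog \<theta>) t > 0)"
proof -
  obtain r :: nat and p where p: "\<And>i. i < r \<Longrightarrow> p i \<in> binary_forms 3" "\<And>x. f x = (\<Sum>i<r. (p i x)\<^sup>2)"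
    using f(1) unfolding Sigma6_def by blast
  then have "\<forall>i<r. \<exists>q. p i = cubic q"
    by (metis range_cubic rangeE)
  then obtain q where q: "\<And>i. i < r \<Longrightarrow> p i = cubic (q i)" by metis
  define \<theta> where "\<theta> = (\<Sum>i<r. tensor_prod (q i) (q i))"
  have sum: "mult_map (\<Sum>i\<in>I. g i) x = (\<Sum>i\<in>I. mult_map (g i) x)" if "finite I" for I :: "nat set" and g x
    using that by (induction I) (simp_all add: mult_map_add, simp add: mult_map_def)
  have f_eq: "mult_map \<theta> = f"
    by (rule ext) (simp add: \<theta>_def sum mult_map_tensor_prod p(2) q power2_eq_square)
  have "mult_map \<theta> (vector [1, 0]) > 0"
    using f(2) by (simp add: f_eq strictly_positive_def vec_eq_iff forall_2)
  then have "\<theta>$1$1 > 0"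
    by (simp add: mult_map_def cubic_monomial_def sum_4)
  then have "degree (dehomog \<theta>) = 6"
    by (simp add: dehomog_def)
  moreover have "poly (dehomog \<theta>) t > 0" for t
    using f(2) by (simp add: poly_dehomog f_eq strictly_positive_def vec_eq_iff forall_2)
  ultimately show ?thesis using f_eq by blast
qed

text \<open>
  Writing \<open>f\<close> on the real line as \<open>c\<^sup>2\<bar>t - z1\<bar>\<^sup>2\<bar>t - z2\<bar>\<^sup>2\<bar>t - z3\<bar>\<^sup>2\<close>, the Gram tensors of rank at most
  two come from the cubics with one root chosen from each pair \<open>zi\<close>, \<open>cnj zi\<close>. As conjugate cubics
  give the same tensor, \<open>z1\<close> may be kept fixed, which leaves four choices. They may coincide if
  roots are repeated, but flipping only \<open>z3\<close> always changes the tensor.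
\<close>

lemma card_Gram_rank_le_2:
  assumes f: "f \<in> Sigma6" "strictly_positive f"
  shows "finite {\<theta> \<in> Gram f. rank \<theta> \<le> 2} \<and> card {\<theta> \<in> Gram f. rank \<theta> \<le> 2} \<in> {2..4}"
proof -
  obtain \<theta>0 where \<theta>0: "mult_map \<theta>0 = f" "degree (dehomog \<theta>0) = 6" "\<And>t. poly (dehomog \<theta>0) t > 0"
    using dehomog_of_Sigma6[OF f] by blast
  obtain c z1 z2 z3 where c: "c > 0" and Im: "Im z1 > 0" "Im z2 > 0" "Im z3 > 0" and
    F: "\<And>t. poly (dehomog \<theta>0) t = (cmod (poly (smult (of_real c) (cubic_with_roots z1 z2 z3)) (of_real t)))\<^sup>2"
    using positive_sextic_factorization[OF \<theta>0(2,3)] by blast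
  define g where "g = (\<lambda>(w2, w3). c\<^sup>2 *\<^sub>R Gram_of (cubic_with_roots z1 w2 w3))"
  define A where "A = g ` ({z2, cnj z2} \<times> {z3, cnj z3})"
  have f_iff: "mult_map \<theta> = f \<longleftrightarrow> (\<forall>t. mult_map \<theta> (vector [t, 1])
      = (cmod (poly (smult (of_real c) (cubic_with_roots z1 z2 z3)) (of_real t)))\<^sup>2)" for \<theta>
  proof -
    have "mult_map \<theta> = f \<longleftrightarrow> poly (dehomog \<theta>) = poly (dehomog \<theta>0)"
      unfolding \<theta>0(1)[symmetric] mult_map_eq_iff poly_eq_poly_eq_iff ..
    then show ?thesis by (simp only: fun_eq_iff F) (simp only: poly_dehomog)
  qed
  have "{\<theta> \<in> Gram f. rank \<theta> \<le> 2} = A"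
  proof
    show "{\<theta> \<in> Gram f. rank \<theta> \<le> 2} \<subseteq> A"
    proof clarify
      fix \<theta> assume \<theta>: "\<theta> \<in> Gram f" "rank \<theta> \<le> 2"
      then obtain p where "\<theta> = (\<Sum>i<(2::nat). tensor_prod (p i) (p i))"
        using psd_sum_of_squares[of \<theta> 2] by (auto simp: Gram_iff)
      then have "\<theta> = tensor_prod (p 0) (p 0) + tensor_prod (p 1) (p 1)"
        by (simp add: eval_nat_numeral)
      then obtain G where G: "degree G \<le> 3" "\<theta> = Gram_of G"
        using sum_of_two_squares_Gram_of by metis
      have "cmod (poly G (of_real t))
          = cmod (poly (smult (of_real c) (cubic_with_roots z1 z2 z3)) (of_real t))" for t
      proof -
        have "(cmod (poly G (of_real t)))\<^sup>2
          = (cmod (poly (smult (of_real c) (cubic_with_roots z1 z2 z3)) (of_real t)))\<^sup>2"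
          using \<theta>(1) unfolding Gram_iff f_iff G(2) mult_map_Gram_of[OF G(1)] by blast
        then show ?thesis
          by (rule power2_eq_imp_eq) simp_all
      qed
      from equal_modulus_cubic[OF this Im c G(1)] obtain u w1 w2 w3 where
        u: "cmod u = c" and w: "w1 \<in> {z1, cnj z1}" "w2 \<in> {z2, cnj z2}" "w3 \<in> {z3, cnj z3}"
        and Gw: "G = smult u (cubic_with_roots w1 w2 w3)"
        by blast
      have \<theta>w: "\<theta> = c\<^sup>2 *\<^sub>R Gram_of (cubic_with_roots w1 w2 w3)"
        by (simp add: G(2) Gw Gram_of_smult u)
      show "\<theta> \<in> A"
      proof (cases "w1 = z1")
        case True
        then have "\<theta> = g (w2, w3)" by (simp add: g_def \<theta>w)
        then show ?thesis unfolding A_def using w by blast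
      next
        case False
        then have "cnj w1 = z1" using w(1) by auto
        then have "Gram_of (cubic_with_roots w1 w2 w3) = Gram_of (cubic_with_roots z1 (cnj w2) (cnj w3))"
          using Gram_of_cnj[of "cubic_with_roots w1 w2 w3"] by (simp add: cnj_cubic_with_roots)
        then have "\<theta> = g (cnj w2, cnj w3)" by (simp add: g_def \<theta>w)
        moreover have "(cnj w2, cnj w3) \<in> {z2, cnj z2} \<times> {z3, cnj z3}" using w(2,3) by auto
        ultimately show ?thesis unfolding A_def by blast
      qed
    qed
    show "A \<subseteq> {\<theta> \<in> Gram f. rank \<theta> \<le> 2}"
    proof
      fix \<theta> assume "\<theta> \<in> A"
      then obtain w2 w3 where w: "w2 \<in> {z2, cnj z2}" "w3 \<in> {z3, cnj z3}" "\<theta> = g (w2, w3)"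
        unfolding A_def by blast
      define G where "G = smult (of_real c) (cubic_with_roots z1 w2 w3)"
      have \<theta>: "\<theta> = Gram_of G"
        using w(3) c by (simp add: G_def g_def Gram_of_smult)
      have "degree G \<le> 3"
        unfolding G_def by (rule order_trans[OF degree_smult_le degree_cubic_with_roots])
      moreover have "cmod (of_real t - w2) = cmod (of_real t - z2)"
        "cmod (of_real t - w3) = cmod (of_real t - z3)" for t
        using w(1,2) by (auto simp: cmod_def)
      then have "cmod (poly G (of_real t))
          = cmod (poly (smult (of_real c) (cubic_with_roots z1 z2 z3)) (of_real t))" for t
        by (simp add: G_def poly_cubic_with_roots norm_mult)
      ultimately have "mult_map \<theta> = f"
        by (simp add: f_iff \<theta> mult_map_Gram_of del: poly_smult)
      then show "\<theta> \<in> {\<theta> \<in> Gram f. rank \<theta> \<le> 2}"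
        using psd_Gram_of rank_Gram_of by (simp add: Gram_iff \<theta>)
    qed
  qed
  moreover have "finite A" by (simp add: A_def)
  moreover have "card A \<le> 4"
  proof -
    have "card A \<le> card ({z2, cnj z2} \<times> {z3, cnj z3})"
      unfolding A_def by (intro card_image_le) simp
    also have "\<dots> \<le> 2 * 2"
      unfolding card_cartesian_product by (intro mult_le_mono) (simp_all add: card_insert_if)
    finally show ?thesis by simp
  qed
  moreover have "2 \<le> card A"
  proof -
    have "g (z2, z3) \<noteq> g (z2, cnj z3)"
      using Gram_of_cubic_distinct[OF Im] c by (simp add: g_def)
    then have "card {g (z2, z3), g (z2, cnj z3)} = 2" by simp
    moreover have "{g (z2, z3), g (z2, cnj z3)} \<subseteq> A" by (auto simp: A_def)
    ultimately show ?thesis using card_mono[OF \<open>finite A\<close>] by metis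
  qed
  ultimately show ?thesis by simp
qed

section \<open>The face structure of the Gram spectrahedron\<close>

theorem proposition6p3:
  fixes f :: "real^2 \<Rightarrow> real"
  assumes "f \<in> Sigma6"
    and "strictly_positive f"
  shows "aff_dim (Gram f) = 3
    \<and> (\<forall>\<theta> \<in> rel_interior (Gram f). rank \<theta> = 4)
    \<and> (\<forall>F. F face_of Gram f \<longrightarrow> aff_dim F \<noteq> 1 \<and> aff_dim F \<noteq> 2)
    \<and> card {\<theta>. \<theta> extreme_point_of Gram f \<and> rank \<theta> \<le> 2} \<in> {4, 3, 2}
    \<and> (\<forall>\<theta>. \<theta> extreme_point_of Gram f \<and> \<not> rank \<theta> \<le> 2 \<longrightarrow> rank \<theta> = 3)"
proof -
  let ?E = "{\<theta> \<in> Gram f. rank \<theta> \<le> 2}"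
  have card: "finite ?E" "card ?E \<le> 4" "2 \<le> card ?E"
    using card_Gram_rank_le_2[OF assms] by auto
  then obtain \<theta>1 \<theta>2 where \<theta>12: "\<theta>1 \<in> Gram f" "\<theta>2 \<in> Gram f" "\<theta>1 \<noteq> \<theta>2"
    by (auto simp: card_le_Suc_iff numeral_2_eq_2)
  note mid = midpoint_rank_4[OF assms(2) \<theta>12]
  have dim: "aff_dim (Gram f) = 3"
    by (rule aff_dim_Gram[OF mid])
  have rank: "rank \<theta> \<le> 3 \<or> rank \<theta> = 4" for \<theta> :: tensor
    using rank_bound[of \<theta>] by auto
  have "\<forall>\<theta> \<in> rel_interior (Gram f). rank \<theta> = 4"
  proof
    fix \<theta> assume \<theta>: "\<theta> \<in> rel_interior (Gram f)"
    have "\<not> \<theta> extreme_point_of Gram f"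
      using extreme_point_not_in_REL_INTERIOR[of \<theta> "Gram f"] \<theta> \<theta>12 by (metis singletonD)
    moreover have "\<theta> \<in> Gram f" using \<theta> rel_interior_subset by blast
    ultimately show "rank \<theta> = 4"
      using extreme_if_rank_le_3[OF assms(2)] rank[of \<theta>] by blast
  qed
  moreover have "aff_dim F \<noteq> 1 \<and> aff_dim F \<noteq> 2" if F: "F face_of Gram f" for F
  proof (rule ccontr)
    assume "\<not> ?thesis"
    then have d: "aff_dim F = 1 \<or> aff_dim F = 2" by blast
    then have "F \<noteq> {}" "\<And>a. F \<noteq> {a}" by auto
    then obtain a b where ab: "a \<in> F" "b \<in> F" "a \<noteq> b" by blast
    then have G: "a \<in> Gram f" "b \<in> Gram f" using face_of_imp_subset[OF F] by auto
    \<comment> \<open>A face with two points contains their midpoint, which has rank four, so it is everything.\<close>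
    have "midpoint a b \<in> F"
      using ab face_of_imp_convex[OF F] by (meson convex_contains_segment midpoint_in_closed_segment subsetD)
    then have "F = Gram f"
      using face_with_rank_4[OF F] midpoint_rank_4[OF assms(2) G ab(3)] by blast
    then show False using d dim by simp
  qed
  moreover have "{\<theta>. \<theta> extreme_point_of Gram f \<and> rank \<theta> \<le> 2} = ?E"
    using extreme_if_rank_le_3[OF assms(2)] by (auto simp: extreme_point_of_def)
  moreover have "card ?E \<in> {4, 3, 2}" using card by auto
  moreover have "rank \<theta> = 3" if \<theta>: "\<theta> extreme_point_of Gram f" "\<not> rank \<theta> \<le> 2" for \<theta>
  proof -
    have "rank \<theta> \<noteq> 4"
    proof
      assume "rank \<theta> = 4"
      then have "{\<theta>} = Gram f"
        using face_with_rank_4[of "{\<theta>}"] \<theta>(1) by (simp add: face_of_singleton)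
      then show False using \<theta>12 by (metis singletonD)
    qed
    then show ?thesis using rank[of \<theta>] \<theta>(2) by auto
  qed
  ultimately show ?thesis using dim by simp
qed

end
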